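(* For every positive integer $M$, the following diagrams commute: $$\mathcal M_{\phi}\circ\tilde{\mathbb B}(x)=\mathbf{\tilde B}(x)\circ\mathcal M_{\phi}\ \text{ as maps } \tilde{\mathcal V}\to\mathcal F_\phi^{(0)},\qquad \mathcal M^*_{\phi}\big(\langle v|\,\tilde{\mathbb C}(x)\big)=\mathcal M^*_{\phi}\big(\langle v|\big)\,\mathbf{\tilde C}(x)\ \text{ in }\mathcal F_\phi^{*(0)}\text{ for all } \langle v|\in\tilde{\mathcal V}^*.$$
   Context: $i$-boson model. $\tilde{\mathcal V}$ has basis $|\underline{\tilde n}\rangle=|n_0\rangle_0\otimes\cdots\otimes|n_M\rangle_M$ and $\tilde{\mathcal V}^*$ has basis $\langle\underline{\tilde n}|=\langle n_0|_0\otimes\cdots\otimes\langle n_M|_M$, with $n_0\in\mathbb Z_{\ge0}$ and $n_j\in\{0,1\}$ for $1\le j\le M$. Operators $\tilde\psi_j,\tilde\psi_j^\dagger$ act on $\tilde{\mathcal V}$, affecting only the $j$-th factor: for $1\le j\le M$, $\tilde\psi_j|n_j\rangle=\frac1{\sqrt2}|n_j-1\rangle$ if $n_j\ge1$ and $0$ otherwise, $\tilde\psi_j^\dagger|n_j\rangle=\frac{1+(-1)^{n_j}}{\sqrt2}|n_j+1\rangle$; for $j=0$, $\tilde\psi_0|n_0\rangle=\frac{1-(-1)^{n_0}}{\sqrt2}|n_0-1\rangle$, $\tilde\psi_0^\dagger|n_0\rangle=\frac1{\sqrt2}|n_0+1\rangle$. They act from the right on $\tilde{\mathcal V}^*$ similarly: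 for $1\le j\le M$, $\langle n_j|\tilde\psi_j=\frac{1+(-1)^{n_j}}{\sqrt2}\langle n_j+1|$, $\langle n_j|\tilde\psi_j^\dagger=\frac1{\sqrt2}\langle n_j-1|$ if $n_j\ge1$ and $0$ otherwise; $\langle n_0|\tilde\psi_0=\frac1{\sqrt2}\langle n_0+1|$, $\langle n_0|\tilde\psi_0^\dagger=\frac{1-(-1)^{n_0}}{\sqrt2}\langle n_0-1|$. Let $$\tilde L_m(x)=\begin{pmatrix}x^{-1/2}&\sqrt2\,\tilde\psi_m^\dagger\\ \sqrt2\,\tilde\psi_m&x^{1/2}\end{pmatrix},\qquad \tilde T(x)=\tilde L_M(x)\cdots\tilde L_0(x)=\begin{pmatrix}\tilde A(x)&\tilde B(x)\\ \tilde C(x)&\tilde D(x)\end{pmatrix},$$ $\tilde{\mathbb B}(x)=x^{M/2}\tilde B(x)$ and $\tilde{\mathbb C}(x)=x^{M/2}\tilde C(1/x)$. Neutral fermions. $\phi_m$ ($m\in\mathbb Z$) satisfy $\{\phi_m,\phi_n\}=2(-1)^m\delta_{m+n,0}$, where $\{A,B\}=AB+BA$. The Fock space and dual Fock space (a right module) are generated by $|0\rangle$ and $\langle 0|$ with $\phi_m|0\rangle=\langle0|\phi_{-m}=0$ for $m<0$; $\mathcal F_\phi^{(0)}$, $\mathcal F_\phi^{*(0)}$ are the subspaces generated by the action of monomials of even length on $|0\rangle$, $\langle0|$. $\mathbf{\tilde B}(x)$ is the ordered product of $\exp\left(\tfrac12x(-1)^j\phi_{-j+1}\phi_j\right)$,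 $-M+1\le j\le M$, with $j$ decreasing from left to right; $\mathbf{\tilde C}(x)$ is the ordered product of $\exp\left(\tfrac12x(-1)^{i-1}\phi_{-i}\phi_{i-1}\right)$, $-M+1\le i\le M$, with $i$ decreasing from right to left (acting from the right on $\mathcal F_\phi^{*(0)}$). For a strict partition $\tilde\nu=(\tilde\nu_1>\cdots>\tilde\nu_\ell>0)$ with $l(\tilde\nu)=\ell$: $|\tilde\nu)=\phi_{\tilde\nu_1}\cdots\phi_{\tilde\nu_\ell}|0\rangle$ ($\ell$ even), $|\tilde\nu)=\phi_{\tilde\nu_1}\cdots\phi_{\tilde\nu_\ell}\phi_0|0\rangle$ ($\ell$ odd); $(\tilde\nu|=\langle0|\phi_{-\tilde\nu_1}\phi_{-\tilde\nu_2}\cdots\phi_{-\tilde\nu_\ell}$ ($\ell$ even), $(\tilde\nu|=\langle0|\phi_0\phi_{-\tilde\nu_1}\phi_{-\tilde\nu_2}\cdots\phi_{-\tilde\nu_\ell}$ ($\ell$ odd). The linear maps $\mathcal M_\phi:\tilde{\mathcal V}\to\mathcal F_\phi^{(0)}$ and $\mathcal M^*_\phi:\tilde{\mathcal V}^*\to\mathcal F_\phi^{*(0)}$ are $\mathcal M_\phi(|\underline{\tilde n}\rangle)=2^{-l(\tilde\nu)}|\tilde\nu)$ and $\mathcal M^*_\phi(\langle\underline{\tilde n}|)=2^{-l(\tilde\nu)}(\tilde\nu|$, where $\tilde\nu=(M^{n_M},\dots,1^{n_1})$ is the strict partition whose parts are the $i\in\{1,\dots,M\}$ with $n_i=1$.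
   Formalization: The second identity is false as written (already for M=1 on the bra with n_1=0); here M*_φ sends ⟨n| to (-1)^{|ν|+l(l-1)/2} 2^{-l(ν)} (ν|, where l=l(ν) and |ν| is the sum of the parts, i.e. with an extra sign; the first identity is unchanged. *)

theory Defs
  imports Complex_Main "HOL-Library.Poly_Mapping" "HOL-Library.Groups_Big_Fun"
begin

section \<open>Free complex vector spaces\<close>

text \<open>
  \<^typ>\<open>'a \<Rightarrow>\<^sub>0 complex\<close> is the complex vector space with basis \<^typ>\<open>'a\<close>; the basis vector of \<open>a\<close> is
  \<open>Poly_Mapping.single a 1\<close>.
\<close>

definition cscale :: "complex \<Rightarrow> ('a \<Rightarrow>\<^sub>0 complex) \<Rightarrow> ('a \<Rightarrow>\<^sub>0 complex)" where
  "cscale c p = Poly_Mapping.map ((*) c) p"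

lemma lookup_cscale [simp]: "Poly_Mapping.lookup (cscale c p) k = c * Poly_Mapping.lookup p k"
  unfolding cscale_def by (simp add: Poly_Mapping.map.rep_eq when_def)

global_interpretation free: vector_space cscale
  by unfold_locales
     (auto intro!: poly_mapping_eqI simp: lookup_add algebra_simps)

definition lin_extend ::
    "(complex \<Rightarrow> 'b \<Rightarrow> 'b) \<Rightarrow> ('a \<Rightarrow> 'b) \<Rightarrow> ('a \<Rightarrow>\<^sub>0 complex) \<Rightarrow> 'b::comm_monoid_add" where
  "lin_extend scale f v = (\<Sum>a\<in>Poly_Mapping.keys v. scale (Poly_Mapping.lookup v a) (f a))"

lemma lin_extend_eq:
  assumes "vector_space scale" "finite A" "Poly_Mapping.keys v \<subseteq> A"
  shows "lin_extend scale f v = (\<Sum>a\<in>A. scale (Poly_Mapping.lookup v a) (f a))"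
proof -
  interpret vector_space scale by fact
  show ?thesis
    unfolding lin_extend_def
    by (rule sum.mono_neutral_left) (use assms in \<open>auto simp: in_keys_iff\<close>)
qed

lemma lin_extend_add:
  assumes "vector_space scale"
  shows "lin_extend scale f (v + w) = lin_extend scale f v + lin_extend scale f w"
proof -
  interpret vector_space scale by fact
  let ?A = "Poly_Mapping.keys v \<union> Poly_Mapping.keys w"
  have "Poly_Mapping.keys (v + w) \<subseteq> ?A" by (rule keys_add)
  then show ?thesis
    by (simp add: lin_extend_eq[OF assms, of ?A] lookup_add scale_left_distrib sum.distrib)
qed

lemma lin_extend_scale:
  assumes "vector_space scale"
  shows "lin_extend scale f (cscale c v) = scale c (lin_extend scale f v)"
proof -
  interpret vector_space scale by fact
  have "Poly_Mapping.keys (cscale c v) \<subseteq> Poly_Mapping.keys v"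
    by (auto simp: in_keys_iff)
  then show ?thesis
    by (simp add: lin_extend_eq[OF assms, of "Poly_Mapping.keys v"] scale_sum_right)
qed

lemma lin_extend_single:
  assumes "vector_space scale"
  shows "lin_extend scale f (Poly_Mapping.single a c) = scale c (f a)"
proof -
  interpret vector_space scale by fact
  show ?thesis by (simp add: lin_extend_eq[OF assms, of "{a}"])
qed

lemma lin_extend_diff:
  assumes "vector_space scale"
  shows "lin_extend scale f (v - w) = lin_extend scale f v - lin_extend scale f w"
  by (metis assms lin_extend_add add_diff_cancel diff_add_cancel)

lemma lin_extend_zero:
  assumes "vector_space scale"
  shows "lin_extend scale f 0 = 0"
  by (simp add: lin_extend_def)

section \<open>The i-boson model\<close>

text \<open>
  An occupation function \<open>n\<close> labels both the ket \<open>|n\<^sub>0\<rangle>\<^sub>0 \<otimes> \<dots> \<otimes> |n\<^sub>M\<rangle>\<^sub>M\<close> and the bra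
  \<open>\<langle>n\<^sub>0|\<^sub>0 \<otimes> \<dots> \<otimes> \<langle>n\<^sub>M|\<^sub>M\<close>; it is \<open>0\<close> outside \<open>{0..M}\<close>.
\<close>

type_synonym occ = "nat \<Rightarrow> nat"
type_synonym ket = "occ \<Rightarrow>\<^sub>0 complex"
type_synonym bra = "occ \<Rightarrow>\<^sub>0 complex"

definition occs :: "nat \<Rightarrow> occ set" where
  "occs M = {n. (\<forall>j\<in>{1..M}. n j \<in> {0, 1}) \<and> (\<forall>j>M. n j = 0)}"

definition ket_space :: "nat \<Rightarrow> ket set" where
  "ket_space M = {v. Poly_Mapping.keys v \<subseteq> occs M}"

definition bra_space :: "nat \<Rightarrow> bra set" where
  "bra_space M = {v. Poly_Mapping.keys v \<subseteq> occs M}"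

abbreviation sqrt2 :: complex where "sqrt2 \<equiv> complex_of_real (sqrt 2)"

definition psi :: "nat \<Rightarrow> ket \<Rightarrow> ket" where
  "psi j = lin_extend cscale (\<lambda>n.
     if j = 0 then Poly_Mapping.single (n(0 := n 0 - 1)) ((1 - (-1) ^ n 0) / sqrt2)
     else if n j \<ge> 1 then Poly_Mapping.single (n(j := n j - 1)) (1 / sqrt2) else 0)"

definition psi_dag :: "nat \<Rightarrow> ket \<Rightarrow> ket" where
  "psi_dag j = lin_extend cscale (\<lambda>n.
     if j = 0 then Poly_Mapping.single (n(0 := n 0 + 1)) (1 / sqrt2)
     else Poly_Mapping.single (n(j := n j + 1)) ((1 + (-1) ^ n j) / sqrt2))"

text \<open>The right actions \<open>\<langle>v| \<mapsto> \<langle>v| \<psi>\<^sub>j\<close> and \<open>\<langle>v| \<mapsto> \<langle>v| \<psi>\<^sub>j\<^sup>\<dagger>\<close>.\<close>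

definition bra_psi :: "nat \<Rightarrow> bra \<Rightarrow> bra" where
  "bra_psi j = lin_extend cscale (\<lambda>n.
     if j = 0 then Poly_Mapping.single (n(0 := n 0 + 1)) (1 / sqrt2)
     else Poly_Mapping.single (n(j := n j + 1)) ((1 + (-1) ^ n j) / sqrt2))"

definition bra_psi_dag :: "nat \<Rightarrow> bra \<Rightarrow> bra" where
  "bra_psi_dag j = lin_extend cscale (\<lambda>n.
     if j = 0 then Poly_Mapping.single (n(0 := n 0 - 1)) ((1 - (-1) ^ n 0) / sqrt2)
     else if n j \<ge> 1 then Poly_Mapping.single (n(j := n j - 1)) (1 / sqrt2) else 0)"

datatype 'v opmat = OpMat (entA: "'v \<Rightarrow> 'v") (entB: "'v \<Rightarrow> 'v") (entC: "'v \<Rightarrow> 'v") (entD: "'v \<Rightarrow> 'v")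

definition opmat_mult :: "'v::plus opmat \<Rightarrow> 'v opmat \<Rightarrow> 'v opmat" where
  "opmat_mult P Q = OpMat
     (\<lambda>v. entA P (entA Q v) + entB P (entC Q v)) (\<lambda>v. entA P (entB Q v) + entB P (entD Q v))
     (\<lambda>v. entC P (entA Q v) + entD P (entC Q v)) (\<lambda>v. entC P (entB Q v) + entD P (entD Q v))"

text \<open>
  Matrix product when the entries act from the right: \<open>\<langle>v| (X Y) = (\<langle>v| X) Y\<close>, so the left factor
  is applied first.
\<close>

definition opmat_rmult :: "'v::plus opmat \<Rightarrow> 'v opmat \<Rightarrow> 'v opmat" where
  "opmat_rmult P Q = OpMat
     (\<lambda>v. entA Q (entA P v) + entC Q (entB P v)) (\<lambda>v. entB Q (entA P v) + entD Q (entB P v))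
     (\<lambda>v. entA Q (entC P v) + entC Q (entD P v)) (\<lambda>v. entB Q (entC P v) + entD Q (entD P v))"

text \<open>The argument \<open>s\<close> plays the role of \<open>x\<^sup>1\<^sup>/\<^sup>2\<close> in the Lax and monodromy matrices.\<close>

definition lax :: "nat \<Rightarrow> complex \<Rightarrow> ket opmat" where
  "lax m s = OpMat (cscale (1 / s)) (\<lambda>v. cscale sqrt2 (psi_dag m v))
                   (\<lambda>v. cscale sqrt2 (psi m v)) (cscale s)"

definition bra_lax :: "nat \<Rightarrow> complex \<Rightarrow> bra opmat" where
  "bra_lax m s = OpMat (cscale (1 / s)) (\<lambda>v. cscale sqrt2 (bra_psi_dag m v))
                       (\<lambda>v. cscale sqrt2 (bra_psi m v)) (cscale s)"

primrec monodromy :: "nat \<Rightarrow> complex \<Rightarrow> ket opmat" where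
  "monodromy 0 s = lax 0 s"
| "monodromy (Suc m) s = opmat_mult (lax (Suc m) s) (monodromy m s)"

primrec bra_monodromy :: "nat \<Rightarrow> complex \<Rightarrow> bra opmat" where
  "bra_monodromy 0 s = bra_lax 0 s"
| "bra_monodromy (Suc m) s = opmat_rmult (bra_lax (Suc m) s) (bra_monodromy m s)"

text \<open>
  \<open>x\<^sup>M\<^sup>/\<^sup>2 B(x)\<close> and the right action of \<open>x\<^sup>M\<^sup>/\<^sup>2 C(1/x)\<close>, with \<open>x\<^sup>1\<^sup>/\<^sup>2 = s\<close> and \<open>(1/x)\<^sup>1\<^sup>/\<^sup>2 = 1/s\<close>. Only integral
  powers of \<open>x = s\<^sup>2\<close> occur in them.
\<close>

definition BB :: "nat \<Rightarrow> complex \<Rightarrow> ket \<Rightarrow> ket" where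
  "BB M s v = cscale (s ^ M) (entB (monodromy M s) v)"

definition bra_CC :: "nat \<Rightarrow> complex \<Rightarrow> bra \<Rightarrow> bra" where
  "bra_CC M s v = cscale (s ^ M) (entC (bra_monodromy M (1 / s)) v)"

section \<open>Neutral fermions and their Fock spaces\<close>

text \<open>
  The Fock space is the left module over the algebra of the \<open>\<phi>\<^sub>m\<close> presented by the generator \<open>|0\<rangle>\<close> and
  the relations \<open>\<phi>\<^sub>m |0\<rangle> = 0\<close> for \<open>m < 0\<close>. A word \<open>[m\<^sub>1, \<dots>, m\<^sub>k]\<close> stands for \<open>\<phi>\<^bsub>m\<^sub>1\<^esub> \<cdots> \<phi>\<^bsub>m\<^sub>k\<^esub> |0\<rangle>\<close>, and for
  \<open>\<langle>0| \<phi>\<^bsub>m\<^sub>1\<^esub> \<cdots> \<phi>\<^bsub>m\<^sub>k\<^esub>\<close> in the dual Fock space, a right module with relations \<open>\<langle>0| \<phi>\<^sub>m = 0\<close> for \<open>m > 0\<close>.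
\<close>

definition clifford_relators :: "(int list \<Rightarrow>\<^sub>0 complex) set" where
  "clifford_relators =
     {Poly_Mapping.single (u @ [m, n] @ w) 1 + Poly_Mapping.single (u @ [n, m] @ w) 1
        - Poly_Mapping.single (u @ w) (if m + n = 0 then 2 * (-1) powi m else 0) | u m n w. True}"

definition fock_null :: "(int list \<Rightarrow>\<^sub>0 complex) set" where
  "fock_null = free.span (clifford_relators \<union> {Poly_Mapping.single (u @ [m]) 1 | u m. m < 0})"

definition dual_null :: "(int list \<Rightarrow>\<^sub>0 complex) set" where
  "dual_null = free.span (clifford_relators \<union> {Poly_Mapping.single (m # u) 1 | u m. m > 0})"

definition fock_eq :: "(int list \<Rightarrow>\<^sub>0 complex) \<Rightarrow> (int list \<Rightarrow>\<^sub>0 complex) \<Rightarrow> bool" where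
  "fock_eq p q \<longleftrightarrow> p - q \<in> fock_null"

definition dual_eq :: "(int list \<Rightarrow>\<^sub>0 complex) \<Rightarrow> (int list \<Rightarrow>\<^sub>0 complex) \<Rightarrow> bool" where
  "dual_eq p q \<longleftrightarrow> p - q \<in> dual_null"

lemma equivp_diff_span: "equivp (\<lambda>p q. p - q \<in> free.span S)"
proof (rule equivpI)
  show "reflp (\<lambda>p q. p - q \<in> free.span S)"
    by (auto intro!: reflpI free.span_zero)
  show "symp (\<lambda>p q. p - q \<in> free.span S)"
    by (auto intro!: sympI dest: free.span_neg)
  show "transp (\<lambda>p q. p - q \<in> free.span S)"
  proof (rule transpI)
    fix p q r assume "p - q \<in> free.span S" "q - r \<in> free.span S"
    then have "(p - q) + (q - r) \<in> free.span S" by (rule free.span_add)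
    then show "p - r \<in> free.span S" by simp
  qed
qed

quotient_type fock = "int list \<Rightarrow>\<^sub>0 complex" / fock_eq
  using equivp_diff_span unfolding fock_eq_def[abs_def] fock_null_def .

quotient_type dual_fock = "int list \<Rightarrow>\<^sub>0 complex" / dual_eq
  using equivp_diff_span unfolding dual_eq_def[abs_def] dual_null_def .

lemma diff_span_add:
  assumes "p - p' \<in> free.span S" "q - q' \<in> free.span S"
  shows "(p + q) - (p' + q') \<in> free.span S"
  using free.span_add[OF assms] by (simp add: algebra_simps)

lemma diff_span_diff:
  assumes "p - p' \<in> free.span S" "q - q' \<in> free.span S"
  shows "(p - q) - (p' - q') \<in> free.span S"
  using free.span_diff[OF assms] by (simp add: algebra_simps)

lemma diff_span_uminus:
  assumes "p - p' \<in> free.span S"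
  shows "(- p) - (- p') \<in> free.span S"
  using free.span_neg[OF assms] by simp

lemma diff_span_scale:
  assumes "p - p' \<in> free.span S"
  shows "cscale c p - cscale c p' \<in> free.span S"
  using free.span_scale[OF assms, of c] by (simp add: free.scale_right_diff_distrib)

instantiation fock :: ab_group_add
begin
lift_definition zero_fock :: fock is 0 .
lift_definition plus_fock :: "fock \<Rightarrow> fock \<Rightarrow> fock" is "(+)"
  unfolding fock_eq_def fock_null_def by (rule diff_span_add)
lift_definition minus_fock :: "fock \<Rightarrow> fock \<Rightarrow> fock" is "(-)"
  unfolding fock_eq_def fock_null_def by (rule diff_span_diff)
lift_definition uminus_fock :: "fock \<Rightarrow> fock" is uminus
  unfolding fock_eq_def fock_null_def by (rule diff_span_uminus)
instance
  by standard (transfer, simp add: fock_eq_def fock_null_def free.span_zero algebra_simps)+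
end

instantiation dual_fock :: ab_group_add
begin
lift_definition zero_dual_fock :: dual_fock is 0 .
lift_definition plus_dual_fock :: "dual_fock \<Rightarrow> dual_fock \<Rightarrow> dual_fock" is "(+)"
  unfolding dual_eq_def dual_null_def by (rule diff_span_add)
lift_definition minus_dual_fock :: "dual_fock \<Rightarrow> dual_fock \<Rightarrow> dual_fock" is "(-)"
  unfolding dual_eq_def dual_null_def by (rule diff_span_diff)
lift_definition uminus_dual_fock :: "dual_fock \<Rightarrow> dual_fock" is uminus
  unfolding dual_eq_def dual_null_def by (rule diff_span_uminus)
instance
  by standard (transfer, simp add: dual_eq_def dual_null_def free.span_zero algebra_simps)+
end

lift_definition fscale :: "complex \<Rightarrow> fock \<Rightarrow> fock" is cscale
  unfolding fock_eq_def fock_null_def by (rule diff_span_scale)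

lift_definition dscale :: "complex \<Rightarrow> dual_fock \<Rightarrow> dual_fock" is cscale
  unfolding dual_eq_def dual_null_def by (rule diff_span_scale)

global_interpretation fock: vector_space fscale
  by unfold_locales
     (transfer, simp add: fock_eq_def fock_null_def free.span_zero free.scale_right_distrib
        free.scale_left_distrib)+

global_interpretation dual: vector_space dscale
  by unfold_locales
     (transfer, simp add: dual_eq_def dual_null_def free.span_zero free.scale_right_distrib
        free.scale_left_distrib)+

lemma lin_extend_diff_span:
  fixes f :: "'a \<Rightarrow> ('b \<Rightarrow>\<^sub>0 complex)"
  assumes "\<And>r. r \<in> S \<Longrightarrow> lin_extend cscale f r \<in> free.span S'"
    and "p - q \<in> free.span S"
  shows "lin_extend cscale f p - lin_extend cscale f q \<in> free.span S'"
proof -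
  have "lin_extend cscale f r \<in> free.span S'" if "r \<in> free.span S" for r
    using that
  proof (induction rule: free.span_induct_alt)
    case base
    then show ?case by (simp add: lin_extend_def free.span_zero)
  next
    case (step c a b)
    then show ?case
      by (simp add: lin_extend_add free.vector_space_axioms lin_extend_scale free.span_add
          free.span_scale assms(1))
  qed
  from this[OF assms(2)] show ?thesis
    by (simp add: lin_extend_diff free.vector_space_axioms)
qed

lemma cscale_single: "cscale c (Poly_Mapping.single a d) = Poly_Mapping.single a (c * d)"
  by (rule poly_mapping_eqI) (simp add: lookup_single when_def)

lift_definition phi :: "int \<Rightarrow> fock \<Rightarrow> fock" is
  "\<lambda>m. lin_extend cscale (\<lambda>w. Poly_Mapping.single (m # w) 1)"
  unfolding fock_eq_def fock_null_def
proof (erule lin_extend_diff_span[rotated])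
  fix m :: int and r :: "int list \<Rightarrow>\<^sub>0 complex"
  assume "r \<in> clifford_relators \<union> {Poly_Mapping.single (u @ [m]) 1 | u m. m < 0}"
  then have "lin_extend cscale (\<lambda>w. Poly_Mapping.single (m # w) 1) r
      \<in> clifford_relators \<union> {Poly_Mapping.single (u @ [m]) 1 | u m. m < 0}"
  proof
    assume "r \<in> clifford_relators"
    then obtain u k n w where r: "r = Poly_Mapping.single (u @ [k, n] @ w) 1
        + Poly_Mapping.single (u @ [n, k] @ w) 1
        - Poly_Mapping.single (u @ w) (if k + n = 0 then 2 * (-1) powi k else 0)"
      unfolding clifford_relators_def by blast
    have "lin_extend cscale (\<lambda>w. Poly_Mapping.single (m # w) 1) r
      = Poly_Mapping.single ((m # u) @ [k, n] @ w) 1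
        + Poly_Mapping.single ((m # u) @ [n, k] @ w) 1
        - Poly_Mapping.single ((m # u) @ w) (if k + n = 0 then 2 * (-1) powi k else 0)"
      unfolding r by (simp add: lin_extend_add lin_extend_diff lin_extend_single
          free.vector_space_axioms cscale_single)
    then show ?thesis unfolding clifford_relators_def by blast
  next
    assume "r \<in> {Poly_Mapping.single (u @ [m]) 1 | u m. m < 0}"
    then obtain u k where r: "r = Poly_Mapping.single (u @ [k]) 1" "k < 0" by blast
    have "lin_extend cscale (\<lambda>w. Poly_Mapping.single (m # w) 1) r
        = Poly_Mapping.single ((m # u) @ [k]) 1"
      unfolding r by (simp add: lin_extend_single free.vector_space_axioms cscale_single)
    then show ?thesis using r by blast
  qed
  then show "lin_extend cscale (\<lambda>w. Poly_Mapping.single (m # w) 1) r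
      \<in> free.span (clifford_relators \<union> {Poly_Mapping.single (u @ [m]) 1 | u m. m < 0})"
    by (rule free.span_base)
qed

text \<open>The right action \<open>\<langle>v| \<mapsto> \<langle>v| \<phi>\<^sub>m\<close>.\<close>

lift_definition dual_phi :: "int \<Rightarrow> dual_fock \<Rightarrow> dual_fock" is
  "\<lambda>m. lin_extend cscale (\<lambda>w. Poly_Mapping.single (w @ [m]) 1)"
  unfolding dual_eq_def dual_null_def
proof (erule lin_extend_diff_span[rotated])
  fix m :: int and r :: "int list \<Rightarrow>\<^sub>0 complex"
  assume "r \<in> clifford_relators \<union> {Poly_Mapping.single (m # u) 1 | u m. m > 0}"
  then have "lin_extend cscale (\<lambda>w. Poly_Mapping.single (w @ [m]) 1) r
      \<in> clifford_relators \<union> {Poly_Mapping.single (m # u) 1 | u m. m > 0}"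
  proof
    assume "r \<in> clifford_relators"
    then obtain u k n w where r: "r = Poly_Mapping.single (u @ [k, n] @ w) 1
        + Poly_Mapping.single (u @ [n, k] @ w) 1
        - Poly_Mapping.single (u @ w) (if k + n = 0 then 2 * (-1) powi k else 0)"
      unfolding clifford_relators_def by blast
    have "lin_extend cscale (\<lambda>w. Poly_Mapping.single (w @ [m]) 1) r
      = Poly_Mapping.single (u @ [k, n] @ (w @ [m])) 1
        + Poly_Mapping.single (u @ [n, k] @ (w @ [m])) 1
        - Poly_Mapping.single (u @ (w @ [m])) (if k + n = 0 then 2 * (-1) powi k else 0)"
      unfolding r by (simp add: lin_extend_add lin_extend_diff lin_extend_single
          free.vector_space_axioms cscale_single)
    then show ?thesis unfolding clifford_relators_def by blast
  next
    assume "r \<in> {Poly_Mapping.single (m # u) 1 | u m. m > 0}"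
    then obtain u k where r: "r = Poly_Mapping.single (k # u) 1" "k > 0" by blast
    have "lin_extend cscale (\<lambda>w. Poly_Mapping.single (w @ [m]) 1) r
        = Poly_Mapping.single (k # (u @ [m])) 1"
      unfolding r by (simp add: lin_extend_single free.vector_space_axioms cscale_single)
    then show ?thesis using r by blast
  qed
  then show "lin_extend cscale (\<lambda>w. Poly_Mapping.single (w @ [m]) 1) r
      \<in> free.span (clifford_relators \<union> {Poly_Mapping.single (m # u) 1 | u m. m > 0})"
    by (rule free.span_base)
qed

lift_definition vac :: fock is "Poly_Mapping.single [] 1" .

lift_definition dual_vac :: dual_fock is "Poly_Mapping.single [] 1" .

lemma phi_add: "phi m (v + w) = phi m v + phi m w"
  by transfer
     (simp add: lin_extend_add free.vector_space_axioms fock_eq_def fock_null_def free.span_zero)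

lemma phi_scale: "phi m (fscale c v) = fscale c (phi m v)"
  by transfer
     (simp add: lin_extend_scale free.vector_space_axioms fock_eq_def fock_null_def free.span_zero)

lemma dual_phi_add: "dual_phi m (v + w) = dual_phi m v + dual_phi m w"
  by transfer
     (simp add: lin_extend_add free.vector_space_axioms dual_eq_def dual_null_def free.span_zero)

lemma dual_phi_scale: "dual_phi m (dscale c v) = dscale c (dual_phi m v)"
  by transfer
     (simp add: lin_extend_scale free.vector_space_axioms dual_eq_def dual_null_def free.span_zero)

lemma poly_mapping_in_span_singles:
  fixes p :: "'a \<Rightarrow>\<^sub>0 complex"
  shows "p \<in> free.span (range (\<lambda>a. Poly_Mapping.single a 1))"
proof (induction p rule: update_induct)
  case const
  then show ?case by (rule free.span_zero)
next
  case (update f a b)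
  have "Poly_Mapping.update a b f = f + cscale b (Poly_Mapping.single a 1)"
    using update(1)
    by (intro poly_mapping_eqI)
       (auto simp: lookup_update lookup_add lookup_single when_def in_keys_iff)
  then show ?case
    using update by (simp add: free.span_add free.span_scale free.span_base)
qed

lemma lin_eq_on_singles:
  fixes f g :: "('a \<Rightarrow>\<^sub>0 complex) \<Rightarrow> ('b \<Rightarrow>\<^sub>0 complex)"
  assumes add: "\<And>p q. f (p + q) = f p + f q" "\<And>p q. g (p + q) = g p + g q"
    and scale: "\<And>c p. f (cscale c p) = cscale c (f p)" "\<And>c p. g (cscale c p) = cscale c (g p)"
    and mem: "\<And>a. f (Poly_Mapping.single a 1) - g (Poly_Mapping.single a 1) \<in> free.span S"
  shows "f p - g p \<in> free.span S"
  using poly_mapping_in_span_singles[of p]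
proof (induction p rule: free.span_induct_alt)
  case base
  have "f 0 = 0" "g 0 = 0" using scale[of 0 0] by simp_all
  then show ?case by (simp add: free.span_zero)
next
  case (step c x y)
  have "f (cscale c x + y) - g (cscale c x + y) = cscale c (f x - g x) + (f y - g y)"
    by (simp add: add scale free.scale_right_diff_distrib)
  then show ?case
    using step mem by (auto intro!: free.span_add free.span_scale)
qed

lemma phi_anticommute:
  "phi m (phi n v) + phi n (phi m v)
     = fscale (if m + n = 0 then 2 * (-1) powi m else 0) v"
proof (transfer, unfold fock_eq_def fock_null_def)
  fix m n :: int and v :: "int list \<Rightarrow>\<^sub>0 complex"
  define F :: "int \<Rightarrow> (int list \<Rightarrow>\<^sub>0 complex) \<Rightarrow> (int list \<Rightarrow>\<^sub>0 complex)" where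
    "F m = lin_extend cscale (\<lambda>w. Poly_Mapping.single (m # w) 1)" for m
  have F: "F m (p + q) = F m p + F m q" "F m (cscale c p) = cscale c (F m p)"
      "F m (Poly_Mapping.single w d) = Poly_Mapping.single (m # w) d" for m p q c w d
    by (simp_all add: F_def lin_extend_add lin_extend_scale lin_extend_single
        free.vector_space_axioms cscale_single)
  let ?c = "if m + n = 0 then 2 * (-1) powi m else 0"
  have "F m (F n v) + F n (F m v) - cscale ?c v \<in> free.span (clifford_relators \<union> {Poly_Mapping.single (u @ [m]) 1 | u m. m < 0})"
  proof (rule lin_eq_on_singles[where f = "\<lambda>v. F m (F n v) + F n (F m v)" and g = "cscale ?c"], goal_cases)
    case (5 w)
    have "Poly_Mapping.single ([] @ [m, n] @ w) 1 + Poly_Mapping.single ([] @ [n, m] @ w) 1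
        - Poly_Mapping.single ([] @ w) ?c \<in> clifford_relators"
      unfolding clifford_relators_def by blast
    then show ?case by (simp add: F cscale_single free.span_base)
  qed (simp_all add: F free.scale_right_distrib free.scale_left_commute)
  then show "lin_extend cscale (\<lambda>w. Poly_Mapping.single (m # w) 1)
      (lin_extend cscale (\<lambda>w. Poly_Mapping.single (n # w) 1) v) + lin_extend cscale (\<lambda>w. Poly_Mapping.single (n # w) 1)
      (lin_extend cscale (\<lambda>w. Poly_Mapping.single (m # w) 1) v) - cscale ?c v \<in> free.span (clifford_relators \<union> {Poly_Mapping.single (u @ [m]) 1 | u m. m < 0})"
    by (simp add: F_def)
qed

lemma phi_vac: "m < 0 \<Longrightarrow> phi m vac = 0"
proof (transfer, unfold fock_eq_def fock_null_def)
  fix m :: int assume "m < 0"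
  then have "Poly_Mapping.single ([] @ [m]) (1::complex)
      \<in> clifford_relators \<union> {Poly_Mapping.single (u @ [m]) 1 | u m. m < 0}"
    by blast
  then show "lin_extend cscale (\<lambda>w. Poly_Mapping.single (m # w) 1) (Poly_Mapping.single [] 1) - 0
      \<in> free.span (clifford_relators \<union> {Poly_Mapping.single (u @ [m]) 1 | u m. m < 0})"
    by (simp add: lin_extend_single free.vector_space_axioms cscale_single free.span_base)
qed

lemma dual_phi_anticommute:
  "dual_phi n (dual_phi m v) + dual_phi m (dual_phi n v)
     = dscale (if m + n = 0 then 2 * (-1) powi m else 0) v"
proof (transfer, unfold dual_eq_def dual_null_def)
  fix m n :: int and v :: "int list \<Rightarrow>\<^sub>0 complex"
  define F :: "int \<Rightarrow> (int list \<Rightarrow>\<^sub>0 complex) \<Rightarrow> (int list \<Rightarrow>\<^sub>0 complex)" where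
    "F m = lin_extend cscale (\<lambda>w. Poly_Mapping.single (w @ [m]) 1)" for m
  have F: "F m (p + q) = F m p + F m q" "F m (cscale c p) = cscale c (F m p)"
      "F m (Poly_Mapping.single w d) = Poly_Mapping.single (w @ [m]) d" for m p q c w d
    by (simp_all add: F_def lin_extend_add lin_extend_scale lin_extend_single
        free.vector_space_axioms cscale_single)
  let ?c = "if m + n = 0 then 2 * (-1) powi m else 0"
  have "F n (F m v) + F m (F n v) - cscale ?c v \<in> free.span (clifford_relators \<union> {Poly_Mapping.single (m # u) 1 | u m. m > 0})"
  proof (rule lin_eq_on_singles[where f = "\<lambda>v. F n (F m v) + F m (F n v)" and g = "cscale ?c"], goal_cases)
    case (5 w)
    have "Poly_Mapping.single (w @ [m, n] @ []) 1 + Poly_Mapping.single (w @ [n, m] @ []) 1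
        - Poly_Mapping.single (w @ []) ?c \<in> clifford_relators"
      unfolding clifford_relators_def by blast
    then show ?case by (simp add: F cscale_single free.span_base)
  qed (simp_all add: F free.scale_right_distrib free.scale_left_commute)
  then show "lin_extend cscale (\<lambda>w. Poly_Mapping.single (w @ [n]) 1)
      (lin_extend cscale (\<lambda>w. Poly_Mapping.single (w @ [m]) 1) v) + lin_extend cscale (\<lambda>w. Poly_Mapping.single (w @ [m]) 1)
      (lin_extend cscale (\<lambda>w. Poly_Mapping.single (w @ [n]) 1) v) - cscale ?c v \<in> free.span (clifford_relators \<union> {Poly_Mapping.single (m # u) 1 | u m. m > 0})"
    by (simp add: F_def)
qed

lemma dual_phi_vac: "m > 0 \<Longrightarrow> dual_phi m dual_vac = 0"
proof (transfer, unfold dual_eq_def dual_null_def)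
  fix m :: int assume "m > 0"
  then have "Poly_Mapping.single (m # []) (1::complex)
      \<in> clifford_relators \<union> {Poly_Mapping.single (m # u) 1 | u m. m > 0}"
    by blast
  then show "lin_extend cscale (\<lambda>w. Poly_Mapping.single (w @ [m]) 1) (Poly_Mapping.single [] 1) - 0
      \<in> free.span (clifford_relators \<union> {Poly_Mapping.single (m # u) 1 | u m. m > 0})"
    by (simp add: lin_extend_single free.vector_space_axioms cscale_single free.span_base)
qed

definition fock_even :: "fock set" where
  "fock_even = fock.span {foldr phi w vac | w. even (length w)}"

definition dual_even :: "dual_fock set" where
  "dual_even = dual.span {foldl (\<lambda>v m. dual_phi m v) dual_vac w | w. even (length w)}"

text \<open>
  The exponential series of a locally nilpotent operator. \<^const>\<open>Sum_any\<close> adds up the finitely many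
  nonzero terms; the operators used below square to zero.
\<close>

definition exp_op :: "(complex \<Rightarrow> 'v \<Rightarrow> 'v) \<Rightarrow> ('v \<Rightarrow> 'v) \<Rightarrow> 'v \<Rightarrow> 'v::comm_monoid_add" where
  "exp_op scale A v = Sum_any (\<lambda>k. scale (1 / fact k) ((A ^^ k) v))"

text \<open>The factor with the largest \<open>j\<close> is leftmost, hence applied last.\<close>

definition boldB :: "nat \<Rightarrow> complex \<Rightarrow> fock \<Rightarrow> fock" where
  "boldB M x =
     foldr (\<lambda>j. exp_op fscale (\<lambda>v. fscale (x / 2 * (-1) powi j) (phi (1 - j) (phi j v))))
       (rev [1 - int M .. int M])"

text \<open>The factor with the smallest \<open>i\<close> is leftmost, hence the first to act from the right.\<close>

definition dual_boldC :: "nat \<Rightarrow> complex \<Rightarrow> dual_fock \<Rightarrow> dual_fock" where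
  "dual_boldC M x v =
     foldl (\<lambda>v i. exp_op dscale
         (\<lambda>v. dscale (x / 2 * (-1) powi (i - 1)) (dual_phi (i - 1) (dual_phi (- i) v))) v)
       v [1 - int M .. int M]"

section \<open>The maps to the Fock spaces\<close>

text \<open>A strict partition is the strictly decreasing list of its parts.\<close>

definition fock_strict :: "nat list \<Rightarrow> fock" where
  "fock_strict \<nu> =
     foldr (\<lambda>k. phi (int k)) \<nu> (if even (length \<nu>) then vac else phi 0 vac)"

definition dual_strict :: "nat list \<Rightarrow> dual_fock" where
  "dual_strict \<nu> =
     foldl (\<lambda>v k. dual_phi (- int k) v) (if even (length \<nu>) then dual_vac else dual_phi 0 dual_vac) \<nu>"

definition occ_partition :: "nat \<Rightarrow> occ \<Rightarrow> nat list" where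
  "occ_partition M n = rev (filter (\<lambda>i. n i = 1) [1..<Suc M])"

definition M_phi :: "nat \<Rightarrow> ket \<Rightarrow> fock" where
  "M_phi M = lin_extend fscale (\<lambda>n. let \<nu> = occ_partition M n in
     fscale (1 / 2 ^ length \<nu>) (fock_strict \<nu>))"

text \<open>
  The vector \<open>(\<nu>| = \<langle>0| \<phi>\<^bsub>-\<nu>\<^sub>1\<^esub> \<cdots> \<phi>\<^bsub>-\<nu>\<^sub>l\<^esub>\<close> (with an extra \<open>\<phi>\<^sub>0\<close> after \<open>\<langle>0|\<close> for odd \<open>l\<close>) pairs with \<open>|\<nu>)\<close> to
  \<open>\<epsilon>(\<nu>) 2\<^sup>l\<close>, where \<open>\<epsilon>(\<nu>) = (-1)\<^bsup>|\<nu>| + l(l-1)/2\<^esup>\<close>: the sign \<open>(-1)\<^bsup>|\<nu>|\<^esup>\<close> comes from the anticommutators and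
  the other one from reversing the product. The map \<open>M_phi_dual\<close> includes \<open>\<epsilon>(\<nu>)\<close>, which normalises the
  pairing to \<open>2\<^sup>l\<close>. The intertwining relation with \<open>dual_boldC\<close> fails for \<open>\<langle>n| \<mapsto> 2\<^sup>-\<^sup>l (\<nu>|\<close> without this sign:
  for \<open>M = 1\<close> the vacuum configuration would give \<open>\<langle>0| + x \<langle>0| \<phi>\<^sub>0 \<phi>\<^bsub>-1\<^esub>\<close> on the i-boson side and
  \<open>\<langle>0| + x \<langle>0| \<phi>\<^bsub>-1\<^esub> \<phi>\<^sub>0 = \<langle>0| - x \<langle>0| \<phi>\<^sub>0 \<phi>\<^bsub>-1\<^esub>\<close> on the fermionic side.
\<close>

definition dual_sign :: "nat list \<Rightarrow> complex" where
  "dual_sign \<nu> = (-1) ^ (sum_list \<nu> + length \<nu> * (length \<nu> - 1) div 2)"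

definition M_phi_dual :: "nat \<Rightarrow> bra \<Rightarrow> dual_fock" where
  "M_phi_dual M = lin_extend dscale (\<lambda>n. let \<nu> = occ_partition M n in
     dscale (dual_sign \<nu> / 2 ^ length \<nu>) (dual_strict \<nu>))"

lemma fock_strict_even: "fock_strict \<nu> \<in> fock_even"
proof -
  define w where "w = map int \<nu> @ (if even (length \<nu>) then [] else [0])"
  have "fock_strict \<nu> = foldr phi w vac"
    by (simp add: fock_strict_def w_def foldr_map o_def)
  moreover have "even (length w)" by (simp add: w_def)
  ultimately show ?thesis
    unfolding fock_even_def by (auto intro!: fock.span_base)
qed

lemma dual_strict_even: "dual_strict \<nu> \<in> dual_even"
proof -
  define w where "w = (if even (length \<nu>) then [] else [0]) @ map (\<lambda>k. - int k) \<nu>"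
  have "dual_strict \<nu> = foldl (\<lambda>v m. dual_phi m v) dual_vac w"
    by (simp add: dual_strict_def w_def foldl_map)
  moreover have "even (length w)" by (simp add: w_def)
  ultimately show ?thesis
    unfolding dual_even_def by (auto intro!: dual.span_base)
qed

lemma M_phi_even: "M_phi M v \<in> fock_even"
  unfolding M_phi_def lin_extend_def Let_def
  using fock_strict_even unfolding fock_even_def
  by (intro fock.span_sum fock.span_scale) blast

lemma M_phi_dual_even: "M_phi_dual M v \<in> dual_even"
  unfolding M_phi_dual_def lin_extend_def Let_def
  using dual_strict_even unfolding dual_even_def
  by (intro dual.span_sum dual.span_scale) blast

end

theory Submission
  imports Defs
begin

text \<open>
  Both sides of the proposition are built site by site, and the two recursions match.

  On the i-boson side the column \<open>(B, D)\<close> of the monodromy matrix satisfies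
  \<open>B\<^bsub>m+1\<^esub> = s\<^bsup>-1\<^esup> B\<^sub>m + \<surd>2 \<psi>\<^sup>\<dagger>\<^bsub>m+1\<^esub> D\<^sub>m\<close> and \<open>D\<^bsub>m+1\<^esub> = \<surd>2 \<psi>\<^bsub>m+1\<^esub> B\<^sub>m + s D\<^sub>m\<close>. Site \<open>0\<close> enters this column
  only through \<open>\<surd>2 \<psi>\<^sup>\<dagger>\<^sub>0\<close>, which raises \<open>n\<^sub>0\<close> with coefficient \<open>1\<close>, so forgetting \<open>n\<^sub>0\<close> is harmless.

  On the fermionic side write \<open>a\<^sub>k = \<phi>\<^sub>k\<close> and \<open>c\<^sub>k = (-1)\<^sup>k \<phi>\<^bsub>-k\<^esub>\<close>, so that \<open>{c\<^sub>j, a\<^sub>k} = 2 \<delta>\<^bsub>jk\<^esub>\<close>. The first and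
  the last of the exponentials coincide: both equal \<open>1 + (x/2) a\<^sub>M c\<^bsub>M-1\<^esub>\<close>. The product \<open>U\<^sub>M\<close> therefore
  arises from \<open>U\<^bsub>M-1\<^esub>\<close> by multiplying with this operator on both sides, and since \<open>a\<^sub>M\<close> commutes with
  \<open>U\<^bsub>M-1\<^esub>\<close> and squares to zero, \<open>U\<^sub>M = U\<^bsub>M-1\<^esub> + (x/2) a\<^sub>M (c\<^bsub>M-1\<^esub> U\<^bsub>M-1\<^esub> + U\<^bsub>M-1\<^esub> c\<^bsub>M-1\<^esub>)\<close> (lemma
  \<open>ord_exp_Suc\<close>). Under the map to Fock space, up to powers of \<open>s\<close>, \<open>B\<^sub>m\<close> corresponds to \<open>U\<^sub>m\<close> and \<open>D\<^sub>m\<close>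
  to the symmetrised product \<open>(c\<^sub>m U\<^sub>m + U\<^sub>m c\<^sub>m) / 2\<close>; the two statements are proved by one induction on
  \<open>m\<close> (\<open>joint_intertwining\<close>). The operator for \<open>D\<close> is odd, so its target carries the other choice of
  innermost vector (\<open>|0\<rangle>\<close> or \<open>\<phi>\<^sub>0 |0\<rangle>\<close>) for each parity of the length; for this reason the maps to Fock
  space are parametrised by a pair of vacua that \<open>\<phi>\<^sub>0\<close> exchanges.

  The dual statement is the same one. The right actions of \<open>\<psi>\<close> and \<open>\<psi>\<^sup>\<dagger>\<close> are the left actions of \<open>\<psi>\<^sup>\<dagger>\<close> and
  \<open>\<psi>\<close>, and operators at different sites commute, so \<open>C(1/x)\<close> acting from the right is \<open>B(x)\<close>
  (\<open>bra_CC_eq_BB\<close>). On the fermionic side \<open>m \<mapsto> -m\<close> turns the dual Fock space into a left module with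
  the same relations and the product for \<open>C\<close> into the one for \<open>B\<close> with \<open>x\<close> replaced by \<open>-x\<close>; the choice
  \<open>a\<^sub>k = (-1)\<^sup>k \<phi>\<^sub>k\<close>, \<open>c\<^sub>k = \<phi>\<^bsub>-k\<^esub>\<close> absorbs this sign.
\<close>

section \<open>Linear maps out of a free vector space\<close>

lemma linear_lin_extend:
  assumes "vector_space scale"
  shows "Vector_Spaces.linear cscale scale (lin_extend scale f)"
  using assms free.vector_space_axioms
  by (simp add: Vector_Spaces.linear_iff lin_extend_add lin_extend_scale)

lemma lin_extend_cong:
  assumes "\<And>n. n \<in> Poly_Mapping.keys v \<Longrightarrow> f n = g n"
  shows "lin_extend scale f v = lin_extend scale g v"
  unfolding lin_extend_def using assms by (intro sum.cong) auto

lemma eq_sum_singles: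
  fixes v :: "'a \<Rightarrow>\<^sub>0 complex"
  shows "v = (\<Sum>n\<in>Poly_Mapping.keys v. cscale (Poly_Mapping.lookup v n) (Poly_Mapping.single n 1))"
  by (rule poly_mapping_eqI)
     (auto simp: lookup_sum lookup_single when_def in_keys_iff if_distrib[of "(*) _"] cong: if_cong)

lemma linear_eq_lin_extend:
  assumes "Vector_Spaces.linear cscale scale F"
  shows "F v = lin_extend scale (\<lambda>n. F (Poly_Mapping.single n 1)) v"
proof -
  interpret Vector_Spaces.linear cscale scale F by fact
  show ?thesis
    by (subst eq_sum_singles[of v]) (simp only: sum scale lin_extend_def)
qed

text \<open>Restricting to the keys lets a linear identity be checked on the admissible occupations only.\<close>

lemma linear_cong_keys:
  assumes "Vector_Spaces.linear cscale scale F" "Vector_Spaces.linear cscale scale G"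
    and "\<And>n. n \<in> Poly_Mapping.keys v \<Longrightarrow> F (Poly_Mapping.single n 1) = G (Poly_Mapping.single n 1)"
  shows "F v = G v"
  unfolding linear_eq_lin_extend[OF assms(1), of v] linear_eq_lin_extend[OF assms(2), of v]
  using assms(3) by (rule lin_extend_cong)

lemma linear_cscale: "Vector_Spaces.linear cscale cscale (cscale k)"
  using free.vector_space_axioms
  by (simp add: Vector_Spaces.linear_iff free.scale_right_distrib mult.commute)

lemma linear_add_fun:
  assumes "Vector_Spaces.linear cscale scale F" "Vector_Spaces.linear cscale scale G"
  shows "Vector_Spaces.linear cscale scale (\<lambda>v. F v + G v)"
  using assms by (auto simp: Vector_Spaces.linear_iff vector_space_def algebra_simps)

lemma linear_comp:
  assumes "Vector_Spaces.linear cscale cscale F" "Vector_Spaces.linear cscale scale G"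
  shows "Vector_Spaces.linear cscale scale (\<lambda>v. G (F v))"
  using assms by (auto simp: Vector_Spaces.linear_iff)

section \<open>Operators on a single site\<close>

definition site_op :: "nat \<Rightarrow> (nat \<Rightarrow> nat) \<Rightarrow> (nat \<Rightarrow> complex) \<Rightarrow> ket \<Rightarrow> ket" where
  "site_op j g h = lin_extend cscale (\<lambda>n. Poly_Mapping.single (n(j := g (n j))) (h (n j)))"

lemma linear_site_op: "Vector_Spaces.linear cscale cscale (site_op j g h)"
  unfolding site_op_def by (rule linear_lin_extend[OF free.vector_space_axioms])

lemma site_op_single:
  "site_op j g h (Poly_Mapping.single n k) = Poly_Mapping.single (n(j := g (n j))) (k * h (n j))"
  unfolding site_op_def by (simp add: lin_extend_single free.vector_space_axioms cscale_single)

lemma psi_eq_site_op: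
  "psi j = site_op j (\<lambda>k. k - 1)
     (\<lambda>k. if j = 0 then (1 - (-1) ^ k) / sqrt2 else if k \<ge> 1 then 1 / sqrt2 else 0)"
  unfolding psi_def site_op_def by (intro arg_cong[where f = "lin_extend cscale"]) auto

lemma psi_dag_eq_site_op:
  "psi_dag j = site_op j (\<lambda>k. k + 1)
     (\<lambda>k. if j = 0 then 1 / sqrt2 else (1 + (-1) ^ k) / sqrt2)"
  unfolding psi_dag_def site_op_def by (intro arg_cong[where f = "lin_extend cscale"]) auto

lemma site_op_commute:
  assumes "i \<noteq> j"
  shows "site_op i g h (site_op j g' h' v) = site_op j g' h' (site_op i g h v)"
  by (rule linear_cong_keys[OF linear_comp[OF linear_site_op linear_site_op]
        linear_comp[OF linear_site_op linear_site_op]])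
     (use assms in \<open>simp add: site_op_single fun_upd_twist mult.commute\<close>)

section \<open>The second column of the monodromy matrix\<close>

lemma linear_monodromy:
  "Vector_Spaces.linear cscale cscale (entB (monodromy m s))"
  "Vector_Spaces.linear cscale cscale (entD (monodromy m s))"
  by (induction m)
     (auto simp: lax_def opmat_mult_def psi_eq_site_op psi_dag_eq_site_op
       intro!: linear_add_fun linear_comp[OF _ linear_cscale] linear_comp[OF _ linear_site_op]
         linear_comp[OF _ linear_comp[OF linear_site_op linear_cscale]]
         linear_cscale linear_site_op free.linear_id[unfolded id_def])

lemma site_op_add: "site_op j g h (v + w) = site_op j g h v + site_op j g h w"
  and site_op_cscale: "site_op j g h (cscale k v) = cscale k (site_op j g h v)"
  using linear_site_op[of j g h] by (auto simp: Vector_Spaces.linear_iff)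

lemma monodromy_commute_site_op:
  assumes "m < j"
  shows "entB (monodromy m s) (site_op j g h v) = site_op j g h (entB (monodromy m s) v)"
    and "entD (monodromy m s) (site_op j g h v) = site_op j g h (entD (monodromy m s) v)"
  using assms
  by (induction m arbitrary: v)
     (simp_all add: lax_def opmat_mult_def psi_eq_site_op psi_dag_eq_site_op site_op_add
        site_op_cscale site_op_commute[where j = j])

lemma bra_psi_eq: "bra_psi = psi_dag" and bra_psi_dag_eq: "bra_psi_dag = psi"
  unfolding bra_psi_def bra_psi_dag_def psi_def psi_dag_def by (rule refl)+

text \<open>
  Replacing \<open>s\<close> by \<open>1/s\<close> and letting the entries act from the right exchanges \<open>A\<close> with \<open>D\<close> and \<open>B\<close> with
  \<open>C\<close> in every Lax matrix. The factors then act in the opposite order, which does not matter because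
  they act on different sites.
\<close>

lemma bra_monodromy_eq:
  assumes "s \<noteq> 0"
  shows "entC (bra_monodromy m (1 / s)) v = entB (monodromy m s) v"
    and "entA (bra_monodromy m (1 / s)) v = entD (monodromy m s) v"
proof (induction m arbitrary: v)
  case 0
  { case 1 show ?case using assms by (simp add: bra_lax_def lax_def bra_psi_eq) }
  { case 2 show ?case using assms by (simp add: bra_lax_def lax_def) }
next
  case (Suc m)
  note lin = linear_monodromy[of m s, unfolded Vector_Spaces.linear_iff]
  { case 1
    show ?case
      by (simp add: bra_lax_def lax_def bra_psi_eq opmat_rmult_def opmat_mult_def Suc lin
          psi_dag_eq_site_op monodromy_commute_site_op add.commute) }
  { case 2
    show ?case
      by (simp add: bra_lax_def lax_def bra_psi_dag_eq opmat_rmult_def opmat_mult_def Suc lin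
          psi_eq_site_op monodromy_commute_site_op add.commute) }
qed

lemma bra_CC_eq_BB: "s \<noteq> 0 \<Longrightarrow> bra_CC M s = BB M s"
  by (simp add: fun_eq_iff bra_CC_def BB_def bra_monodromy_eq)

section \<open>Kets with a prescribed occupation of one site\<close>

definition occ_at :: "nat \<Rightarrow> nat \<Rightarrow> ket \<Rightarrow> bool" where
  "occ_at j e v \<longleftrightarrow> (\<forall>n\<in>Poly_Mapping.keys v. n j = e)"

lemma occ_at_single: "occ_at j e (Poly_Mapping.single n k) \<longleftrightarrow> k = 0 \<or> n j = e"
  by (auto simp: occ_at_def)

lemma occ_at_add: "occ_at j e v \<Longrightarrow> occ_at j e w \<Longrightarrow> occ_at j e (v + w)"
  unfolding occ_at_def using keys_add[of v w] by blast

lemma occ_at_cscale: "occ_at j e v \<Longrightarrow> occ_at j e (cscale k v)"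
  unfolding occ_at_def by (auto simp: in_keys_iff)

lemma occ_at_sum: "(\<And>i. i \<in> I \<Longrightarrow> occ_at j e (f i)) \<Longrightarrow> occ_at j e (sum f I)"
  by (induction I rule: infinite_finite_induct) (auto simp: occ_at_add occ_at_def[of _ _ 0])

lemma occ_at_site_op: "i \<noteq> j \<Longrightarrow> occ_at j e v \<Longrightarrow> occ_at j e (site_op i g h v)"
  unfolding site_op_def lin_extend_def
  by (intro occ_at_sum occ_at_cscale) (auto simp: occ_at_single occ_at_def)

lemma occ_at_monodromy:
  assumes "m < j" "occ_at j e v"
  shows "occ_at j e (entB (monodromy m s) v)" "occ_at j e (entD (monodromy m s) v)"
  using assms
  by (induction m)
     (auto simp: lax_def opmat_mult_def psi_eq_site_op psi_dag_eq_site_op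
       intro!: occ_at_add occ_at_cscale occ_at_site_op)

section \<open>Clifford modules\<close>

lemma exp_op_square_zero:
  assumes "vector_space scale" "\<And>v. N (N v) = 0"
  shows "exp_op scale N v = v + N v"
proof -
  interpret vector_space scale by fact
  have pow: "(N ^^ k) v = 0" if "k \<notin> {0, 1}" for k
  proof -
    from that have "k \<noteq> 0" "k \<noteq> 1" by auto
    then obtain i where "k = Suc (Suc i)" by (metis One_nat_def not0_implies_Suc)
    then show ?thesis by (simp add: assms(2))
  qed
  have "exp_op scale N v = (\<Sum>k\<in>{0, 1}. scale (1 / fact k) ((N ^^ k) v))"
    unfolding exp_op_def
  proof (rule Sum_any.expand_superset)
    show "{k. scale (1 / fact k) ((N ^^ k) v) \<noteq> 0} \<subseteq> {0, 1}"
    proof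
      fix k assume "k \<in> {k. scale (1 / fact k) ((N ^^ k) v) \<noteq> 0}"
      then have "(N ^^ k) v \<noteq> 0" by auto
      then show "k \<in> {0, 1}" using pow by blast
    qed
  qed simp
  then show ?thesis by simp
qed

text \<open>
  Creators \<open>a\<^sub>k\<close> and annihilators \<open>c\<^sub>k\<close> in which the signs \<open>(-1)\<^sup>m\<close> of the anticommutators are absorbed.
  Both \<open>a\<^sub>0\<close> and \<open>c\<^sub>0\<close> stand for the zero mode \<open>\<phi>\<^sub>0\<close>, which squares to \<open>1\<close>; hence the exception \<open>j = k = 0\<close>.
\<close>

locale fermion_modes = vector_space scale
  for scale :: "complex \<Rightarrow> 'v \<Rightarrow> 'v::ab_group_add" +
  fixes a c :: "nat \<Rightarrow> 'v \<Rightarrow> 'v"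
  assumes a_add: "a k (v + w) = a k v + a k w"
    and a_scale: "a k (scale r v) = scale r (a k v)"
    and c_add: "c k (v + w) = c k v + c k w"
    and c_scale: "c k (scale r v) = scale r (c k v)"
    and a_a: "j + k > 0 \<Longrightarrow> a j (a k v) = - a k (a j v)"
    and c_c: "j + k > 0 \<Longrightarrow> c j (c k v) = - c k (c j v)"
    and c_a: "c j (a k v) = scale (if j = k then 2 else 0) v - a k (c j v)"
begin

lemma a_uminus: "a k (- v) = - a k v"
  using a_scale[of k "-1" v] by simp

lemma c_uminus: "c k (- v) = - c k v"
  using c_scale[of k "-1" v] by simp

lemma a_zero: "a k 0 = 0"
  using a_scale[of k 0 0] by simp

lemma c_zero: "c k 0 = 0"
  using c_scale[of k 0 0] by simp

lemma a_diff: "a k (v - w) = a k v - a k w"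
  using a_add[of k v "- w"] by (simp add: a_uminus)

lemma eq_uminus_self: "v = - v \<Longrightarrow> v = 0"
  for v :: 'v
proof -
  assume "v = - v"
  then have "scale 2 v = 0"
    using scale_left_distrib[of 1 1 v] by (simp add: eq_neg_iff_add_eq_0)
  then show ?thesis by simp
qed

lemma a_sq: "k > 0 \<Longrightarrow> a k (a k v) = 0"
  by (rule eq_uminus_self, rule a_a) simp

lemmas mode_linear = a_add a_scale c_add c_scale a_uminus c_uminus a_zero c_zero a_diff

section \<open>The ordered product of exponentials\<close>

text \<open>The exponential of \<open>(x/2) a\<^bsub>m+1\<^esub> c\<^sub>m\<close>, which squares to zero.\<close>

definition pair_exp :: "complex \<Rightarrow> nat \<Rightarrow> 'v \<Rightarrow> 'v" where
  "pair_exp x m v = v + scale (x / 2) (a (Suc m) (c m v))"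

primrec ord_exp :: "complex \<Rightarrow> nat \<Rightarrow> 'v \<Rightarrow> 'v" where
  "ord_exp x 0 v = v"
| "ord_exp x (Suc m) v = pair_exp x m (ord_exp x m (pair_exp x m v))"

lemma pair_exp_add: "pair_exp x m (v + w) = pair_exp x m v + pair_exp x m w"
  and pair_exp_scale: "pair_exp x m (scale r v) = scale r (pair_exp x m v)"
  by (simp_all add: pair_exp_def mode_linear scale_right_distrib mult.commute)

lemma ord_exp_add: "ord_exp x m (v + w) = ord_exp x m v + ord_exp x m w"
  by (induction m arbitrary: v w) (simp_all add: pair_exp_add)

lemma ord_exp_scale: "ord_exp x m (scale r v) = scale r (ord_exp x m v)"
  by (induction m arbitrary: v) (simp_all add: pair_exp_scale)

lemma pair_exp_a: "Suc m < k \<Longrightarrow> pair_exp x m (a k v) = a k (pair_exp x m v)"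
  by (simp add: pair_exp_def mode_linear c_a a_a[of "Suc m" k])

lemma pair_exp_c: "m < k \<Longrightarrow> Suc m < k \<Longrightarrow> pair_exp x m (c k v) = c k (pair_exp x m v)"
  by (simp add: pair_exp_def mode_linear c_a c_c[of k m])

lemma ord_exp_a: "m < k \<Longrightarrow> ord_exp x m (a k v) = a k (ord_exp x m v)"
  by (induction m arbitrary: v) (simp_all add: pair_exp_a)

lemma ord_exp_c: "m < k \<Longrightarrow> ord_exp x m (c k v) = c k (ord_exp x m v)"
  by (induction m arbitrary: v) (simp_all add: pair_exp_c)

text \<open>Twice the fermionic counterpart of the entry \<open>D\<close>, up to powers of \<open>s\<close>.\<close>

definition annih_sym :: "complex \<Rightarrow> nat \<Rightarrow> 'v \<Rightarrow> 'v" where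
  "annih_sym x m v = c m (ord_exp x m v) + ord_exp x m (c m v)"

lemma annih_sym_scale: "annih_sym x m (scale r v) = scale r (annih_sym x m v)"
  by (simp add: annih_sym_def mode_linear ord_exp_scale scale_right_distrib)

lemma ord_exp_uminus: "ord_exp x m (- v) = - ord_exp x m v"
  using ord_exp_scale[of x m "-1" v] by simp

lemma ord_exp_zero: "ord_exp x m 0 = 0"
  using ord_exp_scale[of x m 0 v] by simp

lemma annih_sym_a: "m < k \<Longrightarrow> annih_sym x m (a k v) = - a k (annih_sym x m v)"
  by (simp add: annih_sym_def mode_linear ord_exp_a ord_exp_c ord_exp_uminus c_a)

lemma annih_sym_c: "m < k \<Longrightarrow> annih_sym x m (c k v) = - c k (annih_sym x m v)"
  by (simp add: annih_sym_def mode_linear ord_exp_a ord_exp_c ord_exp_uminus c_c[of m k])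

text \<open>
  In the product of the two outer exponentials with \<open>U\<close> the term quadratic in \<open>a\<^bsub>m+1\<^esub>\<close> drops out, as
  \<open>a\<^bsub>m+1\<^esub>\<close> can be moved through everything between its two occurrences.
\<close>

lemma ord_exp_Suc: "ord_exp x (Suc m) v = ord_exp x m v + scale (x / 2) (a (Suc m) (annih_sym x m v))"
  by (simp add: pair_exp_def annih_sym_def mode_linear ord_exp_add ord_exp_scale ord_exp_a c_a a_sq
      scale_right_distrib add.commute)

text \<open>
  The recursion of \<open>D\<close>: the first term answers to \<open>\<surd>2 \<psi>\<^bsub>m+1\<^esub> B\<^sub>m\<close>, the others to \<open>s D\<^sub>m\<close>. On states with
  site \<open>m+1\<close> empty, only the middle term survives.
\<close>

lemma annih_sym_Suc:
  "annih_sym x (Suc m) v = scale 2 (ord_exp x m (c (Suc m) v)) + scale x (annih_sym x m v)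
     - scale x (a (Suc m) (c (Suc m) (annih_sym x m v)))"
proof -
  have "annih_sym x (Suc m) v = scale 2 (ord_exp x m (c (Suc m) v))
      + (scale (x / 2) (scale 2 (annih_sym x m v) - a (Suc m) (c (Suc m) (annih_sym x m v)))
         - scale (x / 2) (a (Suc m) (c (Suc m) (annih_sym x m v))))"
    unfolding annih_sym_def[of x "Suc m"] ord_exp_Suc
    using scale_left_distrib[of 1 1]
    by (simp add: mode_linear annih_sym_c ord_exp_c c_a algebra_simps)
  moreover have "scale (x / 2) (scale 2 p - q) - scale (x / 2) q = scale x p - scale x q" for p q
  proof -
    have "scale (x / 2) q + scale (x / 2) q = scale x q"
      unfolding scale_left_distrib[symmetric] by simp
    then have "scale x q = scale (x / 2) q + scale (x / 2) q" ..
    then show ?thesis by (simp only: scale_right_diff_distrib scale_scale) simp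
  qed
  ultimately show ?thesis by (simp add: add_diff_eq)
qed

section \<open>Intertwining\<close>

definition vacua :: "'v \<Rightarrow> 'v \<Rightarrow> bool" where
  "vacua u w \<longleftrightarrow> c 0 u = w \<and> c 0 w = u \<and> (\<forall>k>0. c k u = 0 \<and> c k w = 0)"

lemma vacua_swap: "vacua u w \<Longrightarrow> vacua w u"
  by (auto simp: vacua_def)

text \<open>
  The image of a basis vector: the innermost vector is \<open>u\<close> if the partition has an even number of parts
  and \<open>w\<close> otherwise. Creating a part changes the parity, so the vacua are exchanged below it.
\<close>

primrec state :: "nat \<Rightarrow> 'v \<Rightarrow> 'v \<Rightarrow> occ \<Rightarrow> 'v" where
  "state 0 u w n = u"
| "state (Suc m) u w n =
     (if n (Suc m) = 1 then scale (1 / 2) (a (Suc m) (state m w u n)) else state m u w n)"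

lemma c_state: "vacua u w \<Longrightarrow> m < k \<Longrightarrow> c k (state m u w n) = 0"
proof (induction m arbitrary: u w)
  case (Suc m)
  then show ?case
    using Suc.IH[of u w] Suc.IH[of w u] vacua_swap[of u w] by (simp add: mode_linear c_a)
qed (simp add: vacua_def)

lemma state_fun_upd: "m < k \<Longrightarrow> state m u w (n(k := e)) = state m u w n"
  by (induction m arbitrary: u w) auto

definition fock_map :: "nat \<Rightarrow> 'v \<Rightarrow> 'v \<Rightarrow> ket \<Rightarrow> 'v" where
  "fock_map m u w = lin_extend scale (state m u w)"

lemma linear_fock_map: "Vector_Spaces.linear cscale scale (fock_map m u w)"
  unfolding fock_map_def by (rule linear_lin_extend) (rule vector_space_axioms)

lemma fock_map_add: "fock_map m u w (v + v') = fock_map m u w v + fock_map m u w v'"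
  and fock_map_cscale: "fock_map m u w (cscale r v) = scale r (fock_map m u w v)"
  using linear_fock_map[of m u w] by (auto simp: Vector_Spaces.linear_iff)

lemma fock_map_single: "fock_map m u w (Poly_Mapping.single n r) = scale r (state m u w n)"
  unfolding fock_map_def by (rule lin_extend_single) (rule vector_space_axioms)

lemma fock_map_Suc_empty: "occ_at (Suc m) 0 v \<Longrightarrow> fock_map (Suc m) u w v = fock_map m u w v"
  by (rule linear_cong_keys[OF linear_fock_map linear_fock_map]) (auto simp: fock_map_single occ_at_def)

lemma fock_map_Suc_full:
  "occ_at (Suc m) 1 v \<Longrightarrow> fock_map (Suc m) u w v = scale (1 / 2) (a (Suc m) (fock_map m w u v))"
proof (rule linear_cong_keys[where G = "\<lambda>v. scale (1 / 2) (a (Suc m) (fock_map m w u v))",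
      OF linear_fock_map])
  show "Vector_Spaces.linear cscale scale (\<lambda>v. scale (1 / 2) (a (Suc m) (fock_map m w u v)))"
    using vector_space_axioms free.vector_space_axioms
    by (simp add: Vector_Spaces.linear_iff mode_linear fock_map_add fock_map_cscale scale_right_distrib)
qed (auto simp: fock_map_single occ_at_def)

lemma fock_map_raise_empty:
  assumes "occ_at (Suc m) 0 v"
  shows "fock_map (Suc m) u w (psi_dag (Suc m) v) = scale (1 / sqrt2) (a (Suc m) (fock_map m w u v))"
proof (rule linear_cong_keys[where v = v])
  show "Vector_Spaces.linear cscale scale (\<lambda>v. fock_map (Suc m) u w (psi_dag (Suc m) v))"
    unfolding psi_dag_eq_site_op
    by (intro linear_comp[OF _ linear_fock_map] linear_site_op)
  show "Vector_Spaces.linear cscale scale (\<lambda>v. scale (1 / sqrt2) (a (Suc m) (fock_map m w u v)))"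
    using vector_space_axioms free.vector_space_axioms
    by (simp add: Vector_Spaces.linear_iff mode_linear fock_map_add fock_map_cscale
        scale_right_distrib mult.commute)
qed (use assms in \<open>auto simp: psi_dag_eq_site_op site_op_single cscale_single fock_map_single
       state_fun_upd occ_at_def\<close>)

lemma fock_map_lower_full:
  assumes "occ_at (Suc m) 1 v"
  shows "fock_map (Suc m) u w (psi (Suc m) v) = scale (1 / sqrt2) (fock_map m u w v)"
proof (rule linear_cong_keys[where v = v])
  show "Vector_Spaces.linear cscale scale (\<lambda>v. fock_map (Suc m) u w (psi (Suc m) v))"
    unfolding psi_eq_site_op
    by (intro linear_comp[OF _ linear_fock_map] linear_site_op)
  show "Vector_Spaces.linear cscale scale (\<lambda>v. scale (1 / sqrt2) (fock_map m u w v))"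
    using vector_space_axioms free.vector_space_axioms
    by (simp add: Vector_Spaces.linear_iff fock_map_add fock_map_cscale
        scale_right_distrib mult.commute)
qed (use assms in \<open>auto simp: psi_eq_site_op site_op_single cscale_single fock_map_single
       state_fun_upd occ_at_def linear_fock_map\<close>)

end

lemma psi_dag_full: "occ_at (Suc m) 1 v \<Longrightarrow> psi_dag (Suc m) v = 0"
  unfolding psi_dag_def by (subst lin_extend_cong[where g = "\<lambda>_. 0"])
    (auto simp: occ_at_def lin_extend_def)

lemma psi_empty: "occ_at (Suc m) 0 v \<Longrightarrow> psi (Suc m) v = 0"
  unfolding psi_def by (subst lin_extend_cong[where g = "\<lambda>_. 0"])
    (auto simp: occ_at_def lin_extend_def)

context fermion_modes
begin

text \<open>
  The powers of \<open>s\<close> turn the recursions for \<open>B\<close> and \<open>D\<close> into recursions in \<open>x\<close>. The conclusions are needed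
  for both orders of the vacua, since filling site \<open>m+1\<close> and applying the odd operator \<open>D\<close> each
  exchange them. The two cases of the step are an empty and a filled site \<open>m+1\<close>.
\<close>

lemma joint_intertwining:
  assumes "s \<noteq> 0" "s ^ 2 = x" "vacua u w" "\<And>j. j \<in> {1..m} \<Longrightarrow> n j \<in> {0, 1}"
  defines "v \<equiv> Poly_Mapping.single n 1"
  shows "scale (s ^ m) (fock_map m u w (entB (monodromy m s) v)) = ord_exp x m (state m u w n)"
    and "scale (s ^ m) (fock_map m w u (entD (monodromy m s) v)) =
        scale (s / 2) (annih_sym x m (state m u w n))"
proof -
  have "scale (s ^ m) (fock_map m u w (entB (monodromy m s) v)) = ord_exp x m (state m u w n) \<and>
    scale (s ^ m) (fock_map m w u (entD (monodromy m s) v)) =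
        scale (s / 2) (annih_sym x m (state m u w n))"
    using assms(3,4)
  proof (induction m arbitrary: u w)
    case 0
    then show ?case
      using scale_left_distrib[of "s/2" "s/2" w]
      by (simp add: v_def lax_def psi_dag_eq_site_op site_op_single cscale_single fock_map_single
          vacua_def annih_sym_def scale_right_distrib)
  next
    case (Suc m)
    let ?b = "entB (monodromy m s) v" and ?d = "entD (monodromy m s) v"
    let ?y = "state m u w n" and ?z = "state m w u n"
    have x: "x = s * s" using assms(2) by (simp add: power2_eq_square)
    have vac: "vacua w u" by (rule vacua_swap) fact
    have n: "n j \<in> {0, 1}" if "j \<in> {1..m}" for j
      using Suc.prems(2)[of j] that by simp
    have "scale (s ^ m) (fock_map m u w ?b) = ord_exp x m ?y"
        "scale (s ^ m) (fock_map m w u ?d) = scale (s / 2) (annih_sym x m ?y)"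
      using Suc.IH[OF Suc.prems(1)] n by blast+
    note IH = this
    have "scale (s ^ m) (fock_map m w u ?b) = ord_exp x m ?z"
        "scale (s ^ m) (fock_map m u w ?d) = scale (s / 2) (annih_sym x m ?z)"
      using Suc.IH[OF vac] n by blast+
    note IH' = this
    have B: "entB (monodromy (Suc m) s) v = cscale (1 / s) ?b + cscale sqrt2 (psi_dag (Suc m) ?d)"
      and D: "entD (monodromy (Suc m) s) v = cscale sqrt2 (psi (Suc m) ?b) + cscale s ?d"
      by (simp_all add: lax_def opmat_mult_def)
    consider "n (Suc m) = 0" | "n (Suc m) = 1"
      using Suc.prems(2)[of "Suc m"] by force
    then show ?case
    proof cases
      case 1
      then have "occ_at (Suc m) 0 v" by (simp add: v_def occ_at_single)
      then have occ: "occ_at (Suc m) 0 ?b" "occ_at (Suc m) 0 ?d"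
        by (simp_all add: occ_at_monodromy)
      have c0: "c (Suc m) ?y = 0" by (rule c_state[OF Suc.prems(1)]) simp
      have cX: "c (Suc m) (annih_sym x m ?y) = 0"
        using annih_sym_c[of m "Suc m" x ?y] annih_sym_scale[of x m 0 0] by (simp add: c0)
      have "scale (s ^ Suc m) (fock_map (Suc m) u w (entB (monodromy (Suc m) s) v))
          = scale (s ^ m) (fock_map m u w ?b) + scale s (a (Suc m) (scale (s ^ m) (fock_map m w u ?d)))"
        using assms(1)
        by (simp del: monodromy.simps One_nat_def add: B fock_map_add fock_map_cscale
            fock_map_Suc_empty fock_map_raise_empty occ scale_right_distrib mode_linear mult.commute)
      also have "\<dots> = ord_exp x (Suc m) ?y"
        unfolding IH ord_exp_Suc by (simp add: mode_linear x)
      finally have 1: "scale (s ^ Suc m) (fock_map (Suc m) u w (entB (monodromy (Suc m) s) v))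
        = ord_exp x (Suc m) ?y" .
      have "scale (s ^ Suc m) (fock_map (Suc m) w u (entD (monodromy (Suc m) s) v))
          = scale (s * s) (scale (s ^ m) (fock_map m w u ?d))"
        by (simp del: monodromy.simps One_nat_def add: D fock_map_add fock_map_cscale
            fock_map_Suc_empty psi_empty occ mult_ac)
      also have "\<dots> = scale (s / 2) (annih_sym x (Suc m) ?y)"
        unfolding IH annih_sym_Suc cX c0 by (simp add: c0 cX ord_exp_zero a_zero x)
      finally show ?thesis using 1 \<open>n (Suc m) = 0\<close> by simp
    next
      case 2
      then have "occ_at (Suc m) 1 v" by (simp add: v_def occ_at_single)
      then have occ: "occ_at (Suc m) 1 ?b" "occ_at (Suc m) 1 ?d"
        by (simp_all add: occ_at_monodromy)
      have c0: "c (Suc m) ?z = 0" by (rule c_state[OF vac]) simp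
      have cX: "c (Suc m) (annih_sym x m ?z) = 0"
        using annih_sym_c[of m "Suc m" x ?z] annih_sym_scale[of x m 0 0] by (simp add: c0)
      have "scale (s ^ Suc m) (fock_map (Suc m) u w (entB (monodromy (Suc m) s) v))
          = scale (1 / 2) (a (Suc m) (scale (s ^ m) (fock_map m w u ?b)))"
        using assms(1)
        by (simp del: monodromy.simps One_nat_def add: B fock_map_add fock_map_cscale
            fock_map_Suc_full psi_dag_full occ mode_linear mult.commute)
      also have "\<dots> = ord_exp x (Suc m) (scale (1 / 2) (a (Suc m) ?z))"
        unfolding IH' ord_exp_Suc
        by (simp add: mode_linear ord_exp_scale annih_sym_scale ord_exp_a annih_sym_a a_sq)
      finally have 1: "scale (s ^ Suc m) (fock_map (Suc m) u w (entB (monodromy (Suc m) s) v))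
        = ord_exp x (Suc m) (scale (1 / 2) (a (Suc m) ?z))" .
      have "scale (s ^ Suc m) (fock_map (Suc m) w u (entD (monodromy (Suc m) s) v))
          = scale s (scale (s ^ m) (fock_map m w u ?b))
              + scale (s * s / 2) (a (Suc m) (scale (s ^ m) (fock_map m u w ?d)))"
        by (simp del: monodromy.simps One_nat_def add: D fock_map_add fock_map_cscale
            fock_map_Suc_full fock_map_lower_full occ mode_linear scale_right_distrib mult_ac)
      also have "\<dots> = scale (s / 2) (annih_sym x (Suc m) (scale (1 / 2) (a (Suc m) ?z)))"
        unfolding IH' annih_sym_Suc annih_sym_a[OF lessI] annih_sym_scale
        by (simp add: mode_linear ord_exp_scale annih_sym_scale ord_exp_a annih_sym_a a_sq c0 cX c_a
            ord_exp_zero x scale_right_distrib scale_right_diff_distrib)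
          (simp add: scale_left_diff_distrib[symmetric] field_simps)
      finally show ?thesis using 1 \<open>n (Suc m) = 1\<close> by simp
    qed
  qed
  then show "scale (s ^ m) (fock_map m u w (entB (monodromy m s) v)) = ord_exp x m (state m u w n)"
    and "scale (s ^ m) (fock_map m w u (entD (monodromy m s) v)) =
        scale (s / 2) (annih_sym x m (state m u w n))"
    by blast+
qed

theorem fock_map_BB:
  assumes "s \<noteq> 0" "s ^ 2 = x" "vacua u w" "v \<in> ket_space M"
  shows "fock_map M u w (BB M s v) = ord_exp x M (fock_map M u w v)"
proof (rule linear_cong_keys[where v = v])
  show "Vector_Spaces.linear cscale scale (\<lambda>v. fock_map M u w (BB M s v))"
    unfolding BB_def
    by (intro linear_comp[OF _ linear_fock_map] linear_comp[OF _ linear_cscale] linear_monodromy)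
  show "Vector_Spaces.linear cscale scale (\<lambda>v. ord_exp x M (fock_map M u w v))"
    using vector_space_axioms free.vector_space_axioms
    by (simp add: Vector_Spaces.linear_iff fock_map_add fock_map_cscale ord_exp_add ord_exp_scale)
  fix n assume "n \<in> Poly_Mapping.keys v"
  then have "n j \<in> {0, 1}" if "j \<in> {1..M}" for j
    using assms(4) that unfolding ket_space_def occs_def by blast
  then show "fock_map M u w (BB M s (Poly_Mapping.single n 1))
      = ord_exp x M (fock_map M u w (Poly_Mapping.single n 1))"
    using joint_intertwining(1)[OF assms(1-3)]
    by (simp add: BB_def fock_map_cscale fock_map_single)
qed

end

lemma neg_one_powi:
  "(-1) powi int k = (-1 :: complex) ^ k" "(-1) powi (- int k) = (-1 :: complex) ^ k"
  by (simp_all add: power_int_minus power_inverse[symmetric])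

section \<open>Neutral fermions\<close>

locale neutral_fermions = vector_space scale
  for scale :: "complex \<Rightarrow> 'v \<Rightarrow> 'v::ab_group_add" +
  fixes \<phi> :: "int \<Rightarrow> 'v \<Rightarrow> 'v"
  assumes \<phi>_add: "\<phi> m (v + w) = \<phi> m v + \<phi> m w"
    and \<phi>_scale: "\<phi> m (scale r v) = scale r (\<phi> m v)"
    and \<phi>_anticommute:
      "\<phi> m (\<phi> n v) + \<phi> n (\<phi> m v) = scale (if m + n = 0 then 2 * (-1) powi m else 0) v"
begin

lemma \<phi>_swap: "m + n \<noteq> 0 \<Longrightarrow> \<phi> m (\<phi> n v) = - \<phi> n (\<phi> m v)"
  using \<phi>_anticommute[of m n v] by (simp add: eq_neg_iff_add_eq_0)

lemma \<phi>_uminus: "\<phi> m (- v) = - \<phi> m v"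
  using \<phi>_scale[of m "-1" v] by simp

lemma \<phi>_zero: "\<phi> m 0 = 0"
  using \<phi>_scale[of m 0 0] by simp

lemma \<phi>_sq: "m \<noteq> 0 \<Longrightarrow> \<phi> m (\<phi> m v) = 0"
  using \<phi>_anticommute[of m m v] scale_left_distrib[of 1 1 "\<phi> m (\<phi> m v)"] by simp

lemma \<phi>_0_sq: "\<phi> 0 (\<phi> 0 v) = v"
proof -
  have "scale 2 (\<phi> 0 (\<phi> 0 v)) = scale 2 v"
    using \<phi>_anticommute[of 0 0 v] scale_left_distrib[of 1 1 "\<phi> 0 (\<phi> 0 v)"] by simp
  then show ?thesis by simp
qed

text \<open>
  The sign \<open>(-1)\<^sup>k\<close> of the anticommutator of \<open>\<phi>\<^sub>k\<close> and \<open>\<phi>\<^bsub>-k\<^esub>\<close> can be put on the annihilator (\<open>\<sigma> = 1\<close>) or on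
  the creator (\<open>\<sigma> = -1\<close>).
\<close>

lemma fermion_modes_signed:
  assumes "\<sigma> \<in> {1, -1}"
  shows "fermion_modes scale (\<lambda>k v. scale (\<sigma> ^ k) (\<phi> (int k) v))
    (\<lambda>k v. scale ((-\<sigma>) ^ k) (\<phi> (- int k) v))"
proof unfold_locales
  fix j k v
  show "scale ((-\<sigma>) ^ j) (\<phi> (- int j) (scale (\<sigma> ^ k) (\<phi> (int k) v)))
    = scale (if j = k then 2 else 0) v
        - scale (\<sigma> ^ k) (\<phi> (int k) (scale ((-\<sigma>) ^ j) (\<phi> (- int j) v)))"
  proof -
    have "scale ((-\<sigma>) ^ j * \<sigma> ^ k) (\<phi> (- int j) (\<phi> (int k) v) + \<phi> (int k) (\<phi> (- int j) v))
      = scale (if j = k then 2 else 0) v"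
    proof (cases "j = k")
      case True
      have "(-\<sigma>) ^ j * \<sigma> ^ j * (2 * (-1) powi (- int j)) = 2 * ((-\<sigma>) * \<sigma> * (-1)) ^ j"
        by (simp only: power_mult_distrib) (simp add: neg_one_powi)
      also have "\<dots> = 2" using assms by auto
      finally show ?thesis using True by (simp add: \<phi>_anticommute)
    next
      case False
      then show ?thesis by (simp add: \<phi>_anticommute)
    qed
    then show ?thesis
      by (simp add: \<phi>_scale scale_right_distrib mult.commute eq_diff_eq)
  qed
  assume "j + k > 0"
  then have "int j + int k \<noteq> 0" "- int j + - int k \<noteq> 0" by auto
  note swap = this[THEN \<phi>_swap, of v]
  show "scale (\<sigma> ^ j) (\<phi> (int j) (scale (\<sigma> ^ k) (\<phi> (int k) v)))
      = - scale (\<sigma> ^ k) (\<phi> (int k) (scale (\<sigma> ^ j) (\<phi> (int j) v)))"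
    unfolding \<phi>_scale swap(1) by (simp add: mult.commute)
  show "scale ((-\<sigma>) ^ j) (\<phi> (- int j) (scale ((-\<sigma>) ^ k) (\<phi> (- int k) v)))
      = - scale ((-\<sigma>) ^ k) (\<phi> (- int k) (scale ((-\<sigma>) ^ j) (\<phi> (- int j) v)))"
    unfolding \<phi>_scale swap(2) by (simp add: mult.commute)
qed (simp_all add: \<phi>_add \<phi>_scale scale_right_distrib mult.commute)

definition bond :: "complex \<Rightarrow> int \<Rightarrow> 'v \<Rightarrow> 'v" where
  "bond x j = exp_op scale (\<lambda>v. scale (x / 2 * (-1) powi j) (\<phi> (1 - j) (\<phi> j v)))"

text \<open>
  The exponent squares to zero: \<open>\<phi>\<^sub>j\<close> and \<open>\<phi>\<^bsub>1-j\<^esub>\<close> anticommute, and whichever of them is not \<open>\<phi>\<^sub>0\<close> has square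
  zero.
\<close>

lemma bond_eq: "bond x j v = v + scale (x / 2 * (-1) powi j) (\<phi> (1 - j) (\<phi> j v))"
  unfolding bond_def
proof (rule exp_op_square_zero)
  fix v
  have "\<phi> (1 - j) (\<phi> j (\<phi> (1 - j) (\<phi> j v))) = - \<phi> (1 - j) (\<phi> (1 - j) (\<phi> j (\<phi> j v)))"
    by (subst \<phi>_swap[of j "1 - j"]) (simp_all add: \<phi>_uminus)
  also have "\<dots> = 0"
    by (cases "j = 0") (simp_all add: \<phi>_sq \<phi>_zero)
  finally have 0: "\<phi> (1 - j) (\<phi> j (\<phi> (1 - j) (\<phi> j v))) = 0" .
  show "scale (x / 2 * (-1) powi j) (\<phi> (1 - j) (\<phi> j
    (scale (x / 2 * (-1) powi j) (\<phi> (1 - j) (\<phi> j v))))) = 0"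
    by (simp add: \<phi>_scale 0)
qed (rule vector_space_axioms)

text \<open>
  Passing from \<open>M\<close> to \<open>M+1\<close> adds the factors with indices \<open>-M\<close> and \<open>M+1\<close> at the two ends of the product.
  They involve the same two fermions in opposite order, and the sign of the exchange is compensated by
  that of \<open>(-1)\<^sup>j\<close>, so both are the same exponential.
\<close>

lemma fold_bond:
  assumes "\<sigma> \<in> {1, -1}"
  shows "fold (bond (\<sigma> * x)) [1 - int M..int M] v =
    fermion_modes.ord_exp scale (\<lambda>k v. scale (\<sigma> ^ k) (\<phi> (int k) v))
      (\<lambda>k v. scale ((-\<sigma>) ^ k) (\<phi> (- int k) v)) x M v"
proof -
  interpret F: fermion_modes scale "\<lambda>k v. scale (\<sigma> ^ k) (\<phi> (int k) v)"
    "\<lambda>k v. scale ((-\<sigma>) ^ k) (\<phi> (- int k) v)"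
    using assms by (rule fermion_modes_signed)
  show ?thesis
  proof (induction M arbitrary: v)
    case (Suc M)
    have sg: "(- \<sigma>) ^ M * \<sigma> ^ Suc M = \<sigma> * (-1) ^ M"
      using assms by (cases "even M") auto
    have pow: "(-1) powi (int (Suc M)) = - ((-1::complex) ^ M)"
        "(-1) powi (- int M) = ((-1::complex) ^ M)"
      by (simp_all only: neg_one_powi) simp
    have pair_exp: "F.pair_exp x M w
        = w + scale (\<sigma> * x / 2 * (-1) ^ M) (\<phi> (int (Suc M)) (\<phi> (- int M) w))" for w
      unfolding F.pair_exp_def \<phi>_scale scale_scale using sg
      by (auto simp: mult_ac)
    have top: "bond (\<sigma> * x) (int (Suc M)) w = F.pair_exp x M w" for w
      unfolding bond_eq pair_exp pow using \<phi>_swap[of "- int M" "int (Suc M)" w] by simp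
    have bot: "bond (\<sigma> * x) (- int M) w = F.pair_exp x M w" for w
      unfolding bond_eq pair_exp pow by (simp add: add.commute)
    have "[1 - int (Suc M)..int (Suc M)] = - int M # [1 - int M..int M] @ [int (Suc M)]"
      using upto_rec1[of "- int M" "int (Suc M)"] upto_rec2[of "1 - int M" "int (Suc M)"] by simp
    then show ?case
      using top bot Suc by simp
  qed simp
qed

lemma state_eq:
  assumes "\<sigma> \<in> {1, -1}"
  shows "fermion_modes.state scale (\<lambda>k v. scale (\<sigma> ^ k) (\<phi> (int k) v)) M u w n
    = (let \<nu> = occ_partition M n in
        scale (\<sigma> ^ sum_list \<nu> / 2 ^ length \<nu>)
          (foldr (\<lambda>k. \<phi> (int k)) \<nu> (if even (length \<nu>) then u else w)))"
proof -
  interpret F: fermion_modes scale "\<lambda>k v. scale (\<sigma> ^ k) (\<phi> (int k) v)"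
    "\<lambda>k v. scale ((-\<sigma>) ^ k) (\<phi> (- int k) v)"
    using assms by (rule fermion_modes_signed)
  show ?thesis
    by (induction M arbitrary: u w)
       (simp_all add: occ_partition_def Let_def \<phi>_scale power_add)
qed

text \<open>
  No part vanishes, so all the fermions anticommute and reversing the product costs the sign of the
  reversal.
\<close>

lemma foldl_eq_foldr_signed:
  assumes "0 \<notin> set \<nu>"
  shows "foldl (\<lambda>v k. \<phi> (int k) v) v \<nu>
    = scale ((-1) ^ (length \<nu> * (length \<nu> - 1) div 2)) (foldr (\<lambda>k. \<phi> (int k)) \<nu> v)"
  using assms
proof (induction \<nu> arbitrary: v)
  case (Cons k \<nu>)
  have swap: "foldr (\<lambda>k. \<phi> (int k)) \<nu> (\<phi> (int k) v)
      = scale ((-1) ^ length \<nu>) (\<phi> (int k) (foldr (\<lambda>k. \<phi> (int k)) \<nu> v))"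
    if "0 \<notin> set \<nu>" for \<nu> v
    using that
  proof (induction \<nu>)
    case (Cons j \<nu>)
    then have "\<phi> (int j) (\<phi> (int k) y) = - \<phi> (int k) (\<phi> (int j) y)" for y
      by (intro \<phi>_swap) auto
    with Cons show ?case by (simp add: \<phi>_scale)
  qed simp
  have "Suc (length \<nu>) * length \<nu> div 2 = length \<nu> * (length \<nu> - 1) div 2 + length \<nu>"
    by (cases "length \<nu>") (simp_all add: algebra_simps)
  with Cons swap[of \<nu> v] show ?case by (simp add: power_add)
qed simp

text \<open>
  The sign \<open>\<sigma>\<close> only changes \<open>x\<close> to \<open>\<sigma> x\<close> in the fermionic product. The kets see \<open>\<sigma> = 1\<close>; the bras see
  \<open>\<sigma> = -1\<close>, where the weight \<open>\<sigma>\<^bsup>|\<nu>|\<^esup>\<close> is what remains of the normalising sign of the dual map once the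
  factors of \<open>(\<nu>|\<close> are reordered.
\<close>

theorem signed_intertwining:
  assumes "\<sigma> \<in> {1, -1}" "s \<noteq> 0" "s ^ 2 = x" "\<And>m. m < 0 \<Longrightarrow> \<phi> m \<Omega> = 0" "v \<in> ket_space M"
  defines "emb \<equiv> lin_extend scale (\<lambda>n. let \<nu> = occ_partition M n in
    scale (\<sigma> ^ sum_list \<nu> / 2 ^ length \<nu>)
      (foldr (\<lambda>k. \<phi> (int k)) \<nu> (if even (length \<nu>) then \<Omega> else \<phi> 0 \<Omega>)))"
  shows "emb (BB M s v) = fold (bond (\<sigma> * x)) [1 - int M..int M] (emb v)"
proof -
  interpret F: fermion_modes scale "\<lambda>k v. scale (\<sigma> ^ k) (\<phi> (int k) v)"
    "\<lambda>k v. scale ((-\<sigma>) ^ k) (\<phi> (- int k) v)"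
    using assms(1) by (rule fermion_modes_signed)
  have "F.vacua \<Omega> (\<phi> 0 \<Omega>)"
  proof -
    have "\<phi> (- int k) (\<phi> 0 \<Omega>) = 0" if "k > 0" for k
      using \<phi>_swap[of "- int k" 0 \<Omega>] assms(4)[of "- int k"] that by (simp add: \<phi>_zero)
    then show ?thesis
      by (simp add: F.vacua_def \<phi>_0_sq assms(4))
  qed
  moreover have "emb = F.fock_map M \<Omega> (\<phi> 0 \<Omega>)"
    unfolding F.fock_map_def emb_def state_eq[OF assms(1), abs_def] ..
  ultimately show ?thesis
    using F.fock_map_BB[OF assms(2,3) _ assms(5)] fold_bond[OF assms(1)] by simp
qed

end

section \<open>The Fock space and its dual\<close>

interpretation ket: neutral_fermions fscale phi
  by unfold_locales (simp_all add: phi_add phi_scale phi_anticommute)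

text \<open>
  Negating the index turns the right module into a left one: \<open>\<phi>\<^bsub>-m\<^esub>\<close> acting from the right satisfies the
  relations of \<open>\<phi>\<^sub>m\<close>, and the dual vacuum becomes a vacuum.
\<close>

interpretation bra: neutral_fermions dscale "\<lambda>m. dual_phi (- m)"
proof unfold_locales
  fix m n :: int and v
  have "(if - n + - m = 0 then 2 * (-1) powi (- n) else 0)
      = (if m + n = 0 then 2 * (-1) powi m else (0 :: complex))"
    by (cases "m = - n") auto
  then show "dual_phi (- m) (dual_phi (- n) v) + dual_phi (- n) (dual_phi (- m) v)
      = dscale (if m + n = 0 then 2 * (-1) powi m else 0) v"
    using dual_phi_anticommute[of "- m" "- n" v] by (simp only: add.commute)
qed (simp_all add: dual_phi_add dual_phi_scale)

lemma boldB_eq_fold: "boldB M x = fold (ket.bond x) [1 - int M..int M]"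
  unfolding boldB_def ket.bond_def by (simp add: foldr_conv_fold)

lemma dual_boldC_eq_fold: "dual_boldC M x = fold (bra.bond (- x)) [1 - int M..int M]"
proof -
  have "(-1) powi (i - 1) = - ((-1 :: complex) powi i)" for i
    by (simp add: power_int_diff)
  then have bond: "bra.bond (- x) = (\<lambda>i. exp_op dscale
      (\<lambda>v. dscale (x / 2 * (-1) powi (i - 1)) (dual_phi (i - 1) (dual_phi (- i) v))))"
    unfolding bra.bond_def by (simp add: fun_eq_iff)
  show ?thesis
    unfolding bond by (rule ext) (simp only: dual_boldC_def foldl_conv_fold)
qed

lemma M_phi_dual_eq:
  "M_phi_dual M = lin_extend dscale (\<lambda>n. let \<nu> = occ_partition M n in
    dscale ((-1) ^ sum_list \<nu> / 2 ^ length \<nu>)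
      (foldr (\<lambda>k. dual_phi (- int k)) \<nu> (if even (length \<nu>) then dual_vac else dual_phi 0 dual_vac)))"
proof -
  have "dscale (dual_sign \<nu> / 2 ^ length \<nu>) (dual_strict \<nu>)
      = dscale ((-1) ^ sum_list \<nu> / 2 ^ length \<nu>)
          (foldr (\<lambda>k. dual_phi (- int k)) \<nu> (if even (length \<nu>) then dual_vac else dual_phi 0 dual_vac))"
    if "0 \<notin> set \<nu>" for \<nu>
    unfolding dual_strict_def bra.foldl_eq_foldr_signed[OF that] dual.scale_scale dual_sign_def
    by (simp add: power_add power_mult_distrib[symmetric] mult.assoc)
  moreover have "0 \<notin> set (occ_partition M n)" for n
    by (simp add: occ_partition_def)
  ultimately show ?thesis
    unfolding M_phi_dual_def Let_def by simp
qed

theorem propositionC2: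
  fixes M :: nat and x s :: complex
  assumes "M \<ge> 1" and "x \<noteq> 0" and "s ^ 2 = x"
  shows "(\<forall>v\<in>ket_space M. M_phi M (BB M s v) = boldB M x (M_phi M v)) \<and>
         (\<forall>v\<in>bra_space M. M_phi_dual M (bra_CC M s v) = dual_boldC M x (M_phi_dual M v))"
proof (intro conjI ballI)
  have s: "s \<noteq> 0" using assms(2,3) by auto
  {
    fix v assume "v \<in> ket_space M"
    then show "M_phi M (BB M s v) = boldB M x (M_phi M v)"
      using ket.signed_intertwining[of 1, OF _ s assms(3) phi_vac]
      by (simp add: M_phi_def fock_strict_def boldB_eq_fold)
  next
    fix v assume "v \<in> bra_space M"
    then have "v \<in> ket_space M" by (simp add: ket_space_def bra_space_def)
    then show "M_phi_dual M (bra_CC M s v) = dual_boldC M x (M_phi_dual M v)"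
      using bra.signed_intertwining[of "-1", OF _ s assms(3), of dual_vac, unfolded minus_zero] dual_phi_vac
      by (simp add: M_phi_dual_eq bra_CC_eq_BB[OF s] dual_boldC_eq_fold)
  }
qed

end
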